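(* An object $\mathsf{F}=(B,s,Y)$ of $\mathbf{iB}$ is a finite object of $\mathbf{iB}$ if and only if either ($B$ is finite and $\mathsf{F}$ is discrete), or ($B$ is a singleton, $Y=\emptyset$, and $\Sigma$ is finite).
   Context: $\Sigma$ is a set (possibly infinite) containing at least two distinct elements, denoted $0$ and $1$. A Chu space over $\Sigma$ is a triple $(A,r,X)$ with sets $A,X$ and a function $r:A\times X\to\Sigma$. A morphism $\varphi=(\varphi^+,\varphi^-):(A,r,X)\to(B,s,Y)$ consists of functions $\varphi^+:A\to B$, $\varphi^-:Y\to X$ with $s(\varphi^+(a),y)=r(a,\varphi^-(y))$ for all $a,y$; composition is $\varphi_2\circ\varphi_1=(\varphi_2^+\circ\varphi_1^+,\varphi_1^-\circ\varphi_2^-)$. $(A,r,X)$ is extensional if for $x,y\in X$, $r(-,x)=r(-,y)$ implies $x=y$; separable if for $a,b\in A$, $r(a,-)=r(b,-)$ implies $a=b$; biextensional if both; discrete if for every function $f:A\to\Sigma$ there is $x\in X$ with $f=r(-,x)$. $\mathbf{B}$ is the category of biextensional Chu spaces over $\Sigma$, and $\mathbf{iB}$ its subcategory with the same objects whose morphisms are the monomorphisms of $\mathbf{B}$. An $\omega$-sequence in $\mathbf{iB}$ is a family of objects $\mathsf{C}_i$ and $\mathbf{iB}$-morphisms $\varphi_i:\mathsf{C}_i\to\mathsf{C}_{i+1}$ ($i\ge1$); a cocone to $\mathsf{C}$ is a family of $\mathbf{iB}$-morphisms $\psi_i:\mathsf{C}_i\to\mathsf{C}$ with $\psi_{i+1}\circ\varphi_i=\psi_i$;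 it is a colimit in $\mathbf{iB}$ if for every cocone $(\psi'_i:\mathsf{C}_i\to\mathsf{C}')$ in $\mathbf{iB}$ there is a unique $\mathbf{iB}$-morphism $\psi:\mathsf{C}\to\mathsf{C}'$ with $\psi\circ\psi_i=\psi'_i$. An object $\mathsf{F}$ of $\mathbf{iB}$ is a finite object of $\mathbf{iB}$ if for every $\omega$-sequence $(\mathsf{C}_i,\varphi_i)$ in $\mathbf{iB}$ having a colimit $(\psi_i:\mathsf{C}_i\to\mathsf{C})$ in $\mathbf{iB}$ and every $\mathbf{iB}$-morphism $\varphi:\mathsf{F}\to\mathsf{C}$, there exist $i\ge1$ and an $\mathbf{iB}$-morphism $\psi:\mathsf{F}\to\mathsf{C}_i$ with $\varphi=\psi_i\circ\psi$.
   Formalization: The case B = Y = ∅ with Σ finite is excluded, since there F is a finite object yet satisfies neither alternative; and B is taken as the biextensional Chu spaces of size bounded by an arbitrary infinite cardinal, from which the unrestricted claim follows by passing to subobjects. *)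

theory Defs
  imports Main "HOL-Library.FuncSet"
begin

text \<open>
  \<open>\<Sigma>\<close> is the type \<open>'s\<close>. The points and the states of all Chu spaces of the category are drawn from
  the types \<open>'p\<close> and \<open>'x\<close>, which therefore bound the sizes of the objects: if \<open>'p\<close> is infinite and
  \<open>'p \<Rightarrow> 's\<close> injects into \<open>'x\<close>, then the category contains, up to isomorphism, every biextensional
  Chu space over \<open>\<Sigma>\<close> with at most \<open>|'p|\<close> points, since the states of an extensional space
  \<open>(A,r,X)\<close> embed into the functions from \<open>A\<close> to \<open>\<Sigma>\<close>. The values of \<open>r\<close> outside
  \<open>A \<times> X\<close> are never used.
\<close>

record ('p, 'x, 's) chu =
  points :: "'p set"
  states :: "'x set"
  rel :: "'p \<Rightarrow> 'x \<Rightarrow> 's"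

definition chu_extensional :: "('p, 'x, 's) chu \<Rightarrow> bool" where
  "chu_extensional C \<longleftrightarrow>
    (\<forall>x\<in>states C. \<forall>y\<in>states C. (\<forall>a\<in>points C. rel C a x = rel C a y) \<longrightarrow> x = y)"

definition chu_separable :: "('p, 'x, 's) chu \<Rightarrow> bool" where
  "chu_separable C \<longleftrightarrow>
    (\<forall>a\<in>points C. \<forall>b\<in>points C. (\<forall>x\<in>states C. rel C a x = rel C b x) \<longrightarrow> a = b)"

definition chu_biextensional :: "('p, 'x, 's) chu \<Rightarrow> bool" where
  "chu_biextensional C \<longleftrightarrow> chu_extensional C \<and> chu_separable C"

definition chu_discrete :: "('p, 'x, 's) chu \<Rightarrow> bool" where
  "chu_discrete C \<longleftrightarrow>
    (\<forall>f :: 'p \<Rightarrow> 's. \<exists>x\<in>states C. \<forall>a\<in>points C. f a = rel C a x)"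

text \<open>
  Both components of a morphism are \<^const>\<open>undefined\<close> outside their domains, so that HOL equality of
  pairs is equality of morphisms.
\<close>

type_synonym ('p, 'x) chu_mor = "('p \<Rightarrow> 'p) \<times> ('x \<Rightarrow> 'x)"

definition chu_hom :: "('p, 'x, 's) chu \<Rightarrow> ('p, 'x, 's) chu \<Rightarrow> ('p, 'x) chu_mor set" where
  "chu_hom C D =
    {\<phi>. fst \<phi> \<in> points C \<rightarrow>\<^sub>E points D \<and> snd \<phi> \<in> states D \<rightarrow>\<^sub>E states C \<and>
        (\<forall>a\<in>points C. \<forall>y\<in>states D. rel D (fst \<phi> a) y = rel C a (snd \<phi> y))}"

text \<open>\<open>chu_comp C E \<psi> \<phi>\<close> is \<open>\<psi> \<circ> \<phi>\<close> for \<open>\<phi> : C \<rightarrow> D\<close> and \<open>\<psi> : D \<rightarrow> E\<close>.\<close>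

definition chu_comp ::
  "('p, 'x, 's) chu \<Rightarrow> ('p, 'x, 's) chu \<Rightarrow> ('p, 'x) chu_mor \<Rightarrow> ('p, 'x) chu_mor \<Rightarrow> ('p, 'x) chu_mor"
where
  "chu_comp C E \<psi> \<phi> =
    (compose (points C) (fst \<psi>) (fst \<phi>), compose (states E) (snd \<phi>) (snd \<psi>))"

definition iB_hom :: "('p, 'x, 's) chu \<Rightarrow> ('p, 'x, 's) chu \<Rightarrow> ('p, 'x) chu_mor set" where
  "iB_hom C D =
    {\<phi> \<in> chu_hom C D.
       \<forall>(E :: ('p, 'x, 's) chu) \<chi>\<^sub>1 \<chi>\<^sub>2.
         chu_biextensional E \<longrightarrow> \<chi>\<^sub>1 \<in> chu_hom E C \<longrightarrow> \<chi>\<^sub>2 \<in> chu_hom E C \<longrightarrow>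
         chu_comp E D \<phi> \<chi>\<^sub>1 = chu_comp E D \<phi> \<chi>\<^sub>2 \<longrightarrow> \<chi>\<^sub>1 = \<chi>\<^sub>2}"

definition iB_omega_sequence ::
  "(nat \<Rightarrow> ('p, 'x, 's) chu) \<Rightarrow> (nat \<Rightarrow> ('p, 'x) chu_mor) \<Rightarrow> bool" where
  "iB_omega_sequence C \<phi> \<longleftrightarrow>
    (\<forall>i\<ge>1. chu_biextensional (C i) \<and> \<phi> i \<in> iB_hom (C i) (C (i + 1)))"

definition iB_cocone ::
  "(nat \<Rightarrow> ('p, 'x, 's) chu) \<Rightarrow> (nat \<Rightarrow> ('p, 'x) chu_mor) \<Rightarrow>
   ('p, 'x, 's) chu \<Rightarrow> (nat \<Rightarrow> ('p, 'x) chu_mor) \<Rightarrow> bool" where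
  "iB_cocone C \<phi> D \<psi> \<longleftrightarrow>
    chu_biextensional D \<and>
    (\<forall>i\<ge>1. \<psi> i \<in> iB_hom (C i) D \<and> chu_comp (C i) D (\<psi> (i + 1)) (\<phi> i) = \<psi> i)"

definition iB_colimit ::
  "(nat \<Rightarrow> ('p, 'x, 's) chu) \<Rightarrow> (nat \<Rightarrow> ('p, 'x) chu_mor) \<Rightarrow>
   ('p, 'x, 's) chu \<Rightarrow> (nat \<Rightarrow> ('p, 'x) chu_mor) \<Rightarrow> bool" where
  "iB_colimit C \<phi> D \<psi> \<longleftrightarrow>
    iB_cocone C \<phi> D \<psi> \<and>
    (\<forall>D' \<psi>'. iB_cocone C \<phi> D' \<psi>' \<longrightarrow>
       (\<exists>!\<theta>. \<theta> \<in> iB_hom D D' \<and> (\<forall>i\<ge>1. chu_comp (C i) D' \<theta> (\<psi> i) = \<psi>' i)))"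

definition iB_finite_object :: "('p, 'x, 's) chu \<Rightarrow> bool" where
  "iB_finite_object F \<longleftrightarrow>
    chu_biextensional F \<and>
    (\<forall>C \<phi> D \<psi> \<theta>.
       iB_omega_sequence C \<phi> \<longrightarrow> iB_colimit C \<phi> D \<psi> \<longrightarrow> \<theta> \<in> iB_hom F D \<longrightarrow>
       (\<exists>i\<ge>1. \<exists>\<eta>\<in>iB_hom F (C i). \<theta> = chu_comp F D (\<psi> i) \<eta>))"

lemma chu_homD:
  assumes "\<phi> \<in> chu_hom C D"
  shows "a \<in> points C \<Longrightarrow> fst \<phi> a \<in> points D" "y \<in> states D \<Longrightarrow> snd \<phi> y \<in> states C"
   "a \<in> points C \<Longrightarrow> y \<in> states D \<Longrightarrow> rel D (fst \<phi> a) y = rel C a (snd \<phi> y)"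
  using assms unfolding chu_hom_def by auto

lemma iB_injI:
  assumes h: "\<phi> \<in> chu_hom C D" and C: "chu_biextensional C" and i: "inj_on (fst \<phi>) (points C)"
  shows "\<phi> \<in> iB_hom C D"
  unfolding iB_hom_def
proof (intro CollectI conjI allI impI h)
  fix E :: "('a,'b,'c) chu" and x1 x2
  assume E: "chu_biextensional E" and x1: "x1 \<in> chu_hom E C" and x2: "x2 \<in> chu_hom E C"
    and eq: "chu_comp E D \<phi> x1 = chu_comp E D \<phi> x2"
  have p: "fst x1 a = fst x2 a" if "a \<in> points E" for a
  proof -
    have "fst \<phi> (fst x1 a) = fst \<phi> (fst x2 a)"
      using eq that unfolding chu_comp_def by (auto simp: compose_def dest: fun_cong[where x=a])
    thus ?thesis using i chu_homD(1)[OF x1 that] chu_homD(1)[OF x2 that] by (meson inj_onD)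
  qed
  have f: "fst x1 = fst x2"
    by (rule PiE_ext[of _ "points E" "\<lambda>_. points C"]) (use x1 x2 p in \<open>auto simp: chu_hom_def\<close>)
  have "snd x1 y = snd x2 y" if "y \<in> states C" for y
  proof -
    have "rel E a (snd x1 y) = rel E a (snd x2 y)" if "a \<in> points E" for a
      using chu_homD(3)[OF x1 that \<open>y \<in> _\<close>] chu_homD(3)[OF x2 that \<open>y \<in> _\<close>] f by simp
    thus ?thesis using E chu_homD(2)[OF x1 that] chu_homD(2)[OF x2 that]
      unfolding chu_biextensional_def chu_extensional_def by blast
  qed
  hence "snd x1 = snd x2"
    by (intro PiE_ext[of _ "states C" "\<lambda>_. states E"]) (use x1 x2 in \<open>auto simp: chu_hom_def\<close>)
  with f show "x1 = x2" by (simp add: prod_eq_iff)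
qed

lemma iB_inj:
  fixes C D :: "('p,'x,'s) chu"
  assumes m: "\<phi> \<in> iB_hom C D" and e: "inj (e :: 's \<Rightarrow> 'x)"
  shows "inj_on (fst \<phi>) (points C)"
proof (rule inj_onI)
  fix a b assume a: "a \<in> points C" and b: "b \<in> points C" and ab: "fst \<phi> a = fst \<phi> b"
  have h: "\<phi> \<in> chu_hom C D" using m by (simp add: iB_hom_def)
  define E :: "('p,'x,'s) chu" where
    "E = \<lparr>points = {undefined}, states = range e, rel = (\<lambda>_ x. inv e x)\<rparr>"
  define g :: "'p \<Rightarrow> ('p,'x) chu_mor" where "g c = (\<lambda>p\<in>{undefined}. c, \<lambda>y\<in>states C. e (rel C c y))" for c
  have E: "chu_biextensional E"
    using e by (auto simp: E_def chu_biextensional_def chu_extensional_def chu_separable_def)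
  have gh: "g c \<in> chu_hom E C" if "c \<in> points C" for c
    using that e by (auto simp: chu_hom_def g_def E_def)
  have "chu_comp E D \<phi> (g a) = chu_comp E D \<phi> (g b)"
    using ab a b chu_homD[OF h]
    by (auto simp: chu_comp_def g_def compose_def E_def fun_eq_iff restrict_def) (metis)
  hence "g a = g b" using m E gh a b unfolding iB_hom_def by blast
  hence "fst (g a) undefined = fst (g b) undefined" by simp
  thus "a = b" by (simp add: g_def)
qed

text \<open>
  The space with no points and no states satisfies neither alternative of the characterization of the
  finite objects, but it is a finite object whenever \<open>\<Sigma>\<close> is finite; this is why the theorem excludes it
  in that case. Any space that receives a morphism from it has no states, hence at most one point, and
  a decreasing sequence of nonempty subsets of a finite \<open>\<Sigma>\<close> cannot have an empty intersection.
\<close>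

lemma empty_chu_finite_object:
  fixes F :: "('p, 'x, 's) chu"
  assumes fin: "finite (UNIV :: 's set)" and e: "inj (e :: 's \<Rightarrow> 'x)"
    and F: "points F = {}" "states F = {}"
  shows "iB_finite_object F \<and> chu_biextensional F \<and>
   \<not> ((finite (points F) \<and> chu_discrete F) \<or>
    (is_singleton (points F) \<and> states F = {} \<and> finite (UNIV :: 's set)))"
proof -
  have Fb: "chu_biextensional F"
    using F by (auto simp: chu_biextensional_def chu_extensional_def chu_separable_def)
  have "\<exists>i\<ge>1. \<exists>\<eta>\<in>iB_hom F (C i). \<theta> = chu_comp F D (\<psi> i) \<eta>"
    if om: "iB_omega_sequence C \<phi>" and co: "iB_colimit C \<phi> D \<psi>" and th: "\<theta> \<in> iB_hom F D"
    for C :: "nat \<Rightarrow> ('p,'x,'s) chu" and \<phi> D \<psi> \<theta>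
  proof -
    have thh: "\<theta> \<in> chu_hom F D" using th by (simp add: iB_hom_def)
    have sD: "states D = {}" using chu_homD(2)[OF thh] F by auto
    have cc: "iB_cocone C \<phi> D \<psi>" using co by (simp add: iB_colimit_def)
    have Cb: "chu_biextensional (C i)" if "i \<ge> 1" for i using om that by (simp add: iB_omega_sequence_def)
    have ps: "\<psi> i \<in> iB_hom (C i) D" "chu_comp (C i) D (\<psi> (i + 1)) (\<phi> i) = \<psi> i" if "i \<ge> 1" for i
      using cc that by (auto simp: iB_cocone_def)
    have psh: "\<psi> i \<in> chu_hom (C i) D" if "i \<ge> 1" for i using ps(1)[OF that] by (simp add: iB_hom_def)
    have ph: "\<phi> i \<in> chu_hom (C i) (C (i+1))" if "i \<ge> 1" for i
      using om that by (simp add: iB_hom_def iB_omega_sequence_def)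
    have D1: "a = b" if "a \<in> points D" "b \<in> points D" for a b
      using cc that sD unfolding iB_cocone_def chu_biextensional_def chu_separable_def by auto
    have C1: "a = b" if "i \<ge> 1" "a \<in> points (C i)" "b \<in> points (C i)" for a b i
      using iB_inj[OF ps(1)[OF that(1)] e] that D1 chu_homD(1)[OF psh[OF that(1)]] by (meson inj_onD)
    have "\<exists>i\<ge>1. states (C i) = {}"
    proof (rule ccontr)
      assume "\<not> ?thesis"
      hence ne: "states (C i) \<noteq> {}" if "i \<ge> 1" for i using that by auto
      define S where "S i = {v. \<exists>x\<in>states (C i). \<forall>a\<in>points (C i). rel (C i) a x = v}" for i
      have step: "S (i+1) \<subseteq> S i" if i: "i \<ge> 1" for i
      proof
        fix v assume "v \<in> S (i+1)"
        then obtain x where x: "x \<in> states (C (i+1))" "\<forall>a\<in>points (C (i+1)). rel (C (i+1)) a x = v"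
          by (auto simp: S_def)
        show "v \<in> S i" unfolding S_def
          using chu_homD[OF ph[OF i]] x by (auto intro!: bexI[of _ "snd (\<phi> i) x"]) metis
      qed
      have mono: "S (i + k) \<subseteq> S i" if "i \<ge> 1" for i k
        by (induction k) (use step that in \<open>auto, metis Suc_eq_plus1 add_leD1 le_add1 order_trans subsetD trans_le_add1\<close>)
      have Sne: "S i \<noteq> {}" if i: "i \<ge> 1" for i
      proof -
        obtain x where x: "x \<in> states (C i)" using ne[OF i] by auto
        show ?thesis
        proof (cases "points (C i) = {}")
          case True thus ?thesis using x by (auto simp: S_def)
        next
          case False then obtain a where a: "a \<in> points (C i)" by auto
          have "rel (C i) a x \<in> S i" using x C1[OF i a] by (auto simp: S_def)
          thus ?thesis by blast
        qed
      qed
      have "\<exists>v. \<forall>i\<ge>1. v \<in> S i"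
      proof (rule ccontr)
        assume "\<not> ?thesis"
        then obtain n where n: "\<And>v. n v \<ge> 1 \<and> v \<notin> S (n v)" by metis
        define N where "N = Max (range n)"
        have N: "n v \<le> N" for v using fin by (simp add: N_def)
        have "N \<ge> 1" using n N le_trans by blast
        then obtain v where "v \<in> S N" using Sne by blast
        hence "v \<in> S (n v)" using mono[of "n v" "N - n v"] N[of v] n[of v] by auto
        thus False using n by blast
      qed
      then obtain v where v: "\<And>i. i \<ge> 1 \<Longrightarrow> v \<in> S i" by blast
      then obtain x where x: "\<And>i. i \<ge> 1 \<Longrightarrow> x i \<in> states (C i)"
        "\<And>i a. i \<ge> 1 \<Longrightarrow> a \<in> points (C i) \<Longrightarrow> rel (C i) a (x i) = v" unfolding S_def by simp metis
      define D' :: "('p,'x,'s) chu" where "D' = \<lparr>points = points D, states = {undefined}, rel = (\<lambda>_ _. v)\<rparr>"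
      define \<psi>' where "\<psi>' i = (fst (\<psi> i), \<lambda>y\<in>{undefined::'x}. x i)" for i
      have D': "chu_biextensional D'"
        using D1 by (auto simp: D'_def chu_biextensional_def chu_extensional_def chu_separable_def)
      have "iB_cocone C \<phi> D' \<psi>'"
        unfolding iB_cocone_def
      proof (intro conjI allI impI D')
        fix i :: nat assume i: "1 \<le> i"
        have "\<psi>' i \<in> chu_hom (C i) D'" using psh[OF i] x i by (auto simp: chu_hom_def D'_def \<psi>'_def)
        moreover have "inj_on (fst (\<psi>' i)) (points (C i))" using iB_inj[OF ps(1)[OF i] e] by (simp add: \<psi>'_def)
        ultimately show "\<psi>' i \<in> iB_hom (C i) D'" using iB_injI Cb[OF i] by blast
        have xs: "snd (\<phi> i) (x (i+1)) = x i"
        proof -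
          have i1: "1 \<le> i+1" by simp
          have m: "snd (\<phi> i) (x (i+1)) \<in> states (C i)" using chu_homD(2)[OF ph[OF i]] x(1)[OF i1] by blast
          have "rel (C i) a (snd (\<phi> i) (x (i+1))) = rel (C i) a (x i)" if "a \<in> points (C i)" for a
            using chu_homD(3)[OF ph[OF i] that x(1)[OF i1]] x(2)[OF i that] x(2)[OF i1 chu_homD(1)[OF ph[OF i] that]]
            by simp
          thus ?thesis using m x(1)[OF i] Cb[OF i] unfolding chu_biextensional_def chu_extensional_def by blast
        qed
        show "chu_comp (C i) D' (\<psi>' (i + 1)) (\<phi> i) = \<psi>' i"
          using ps(2)[OF i] xs by (auto simp: chu_comp_def \<psi>'_def D'_def compose_def fun_eq_iff prod_eq_iff)
      qed
      then obtain \<theta>' where "\<theta>' \<in> iB_hom D D'" using co unfolding iB_colimit_def by blast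
      hence "\<theta>' \<in> chu_hom D D'" by (simp add: iB_hom_def)
      from chu_homD(2)[OF this, of undefined] sD show False by (simp add: D'_def)
    qed
    then obtain i where i: "i \<ge> 1" "states (C i) = {}" by blast
    have "(\<lambda>_. undefined, \<lambda>_. undefined) \<in> chu_hom F (C i)" using F i by (auto simp: chu_hom_def)
    hence 1: "(\<lambda>_. undefined, \<lambda>_. undefined) \<in> iB_hom F (C i)" using iB_injI Fb F by fastforce
    have "\<theta> = chu_comp F D (\<psi> i) (\<lambda>_. undefined, \<lambda>_. undefined)"
      using thh F sD by (auto simp: chu_hom_def chu_comp_def compose_def prod_eq_iff fun_eq_iff)
    with 1 i show ?thesis by blast
  qed
  hence "iB_finite_object F" using Fb unfolding iB_finite_object_def by blast
  thus ?thesis using Fb F by (auto simp: chu_discrete_def is_singleton_def)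
qed

end

theory Submission
  imports Defs
begin

text \<open>
  The points of a colimit in \<open>iB\<close> are the union of the images of the cocone, so finitely many of them
  lie in one stage, and out of a discrete space any map of points is a morphism. Conversely, an
  increasing sequence of point sets with a decreasing sequence of state sets has as colimit the union
  of the points with the intersection of the states. A space with infinitely many points is defeated
  by a sequence that only grows in points, one that is not discrete by a sequence that only shrinks
  in states.
\<close>

section \<open>Morphisms determined by their point maps\<close>

lemma fst_chu_comp: "a \<in> points C \<Longrightarrow> fst (chu_comp C E \<psi> \<phi>) a = fst \<psi> (fst \<phi> a)"
  by (simp add: chu_comp_def compose_def)

lemma snd_chu_comp: "y \<in> states E \<Longrightarrow> snd (chu_comp C E \<psi> \<phi>) y = snd \<phi> (snd \<psi> y)"
  by (simp add: chu_comp_def compose_def)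

lemma chu_hom_comp:
  assumes "\<phi> \<in> chu_hom C D" "\<psi> \<in> chu_hom D E"
  shows "chu_comp C E \<psi> \<phi> \<in> chu_hom C E"
  using assms chu_homD[OF assms(1)] chu_homD[OF assms(2)]
  by (auto simp: chu_hom_def chu_comp_def compose_def)

text \<open>The morphism condition fixes the value of the pulled-back state at every point of
  \<open>C\<close>, and extensionality turns this into equality of states.\<close>

lemma chu_hom_eqI:
  assumes \<phi>: "\<phi> \<in> chu_hom C D" and \<psi>: "\<psi> \<in> chu_hom C D" and C: "chu_biextensional C"
    and eq: "\<And>a. a \<in> points C \<Longrightarrow> fst \<phi> a = fst \<psi> a"
  shows "\<phi> = \<psi>"
proof (rule prod_eqI)
  show "fst \<phi> = fst \<psi>"
    by (rule PiE_ext[of _ "points C" "\<lambda>_. points D"]) (use \<phi> \<psi> eq in \<open>auto simp: chu_hom_def\<close>)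
  have "snd \<phi> y = snd \<psi> y" if y: "y \<in> states D" for y
  proof -
    have "rel C a (snd \<phi> y) = rel C a (snd \<psi> y)" if "a \<in> points C" for a
      using chu_homD(3)[OF \<phi> that y] chu_homD(3)[OF \<psi> that y] eq[OF that] by simp
    then show ?thesis
      using C chu_homD(2)[OF \<phi> y] chu_homD(2)[OF \<psi> y]
      unfolding chu_biextensional_def chu_extensional_def by blast
  qed
  then show "snd \<phi> = snd \<psi>"
    by (intro PiE_ext[of _ "states D" "\<lambda>_. states C"]) (use \<phi> \<psi> in \<open>auto simp: chu_hom_def\<close>)
qed

text \<open>Since the point map decides equality, commuting triangles are checked on points
  only.\<close>

lemma chu_comp_eqI:
  assumes "\<phi> \<in> chu_hom C D" "\<psi> \<in> chu_hom D E" "\<chi> \<in> chu_hom C E" "chu_biextensional C"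
    and "\<And>a. a \<in> points C \<Longrightarrow> fst \<psi> (fst \<phi> a) = fst \<chi> a"
  shows "chu_comp C E \<psi> \<phi> = \<chi>"
  using assms by (intro chu_hom_eqI[OF chu_hom_comp]) (auto simp: fst_chu_comp)

lemma iB_homD: "\<phi> \<in> iB_hom C D \<Longrightarrow> \<phi> \<in> chu_hom C D"
  by (simp add: iB_hom_def)

text \<open>Monomorphisms are handled as morphisms injective on points. The embedding
  \<open>e\<close> serves \<open>iB_inj\<close>, whose one-point test space has a state for every
  letter of the alphabet.\<close>

lemma iB_hom_comp:
  fixes C D E :: "('p,'x,'s) chu"
  assumes e: "inj (e :: 's \<Rightarrow> 'x)" and C: "chu_biextensional C"
    and \<phi>: "\<phi> \<in> iB_hom C D" and \<psi>: "\<psi> \<in> iB_hom D E"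
  shows "chu_comp C E \<psi> \<phi> \<in> iB_hom C E"
proof (rule iB_injI[OF chu_hom_comp[OF iB_homD[OF \<phi>] iB_homD[OF \<psi>]] C])
  show "inj_on (fst (chu_comp C E \<psi> \<phi>)) (points C)"
    using iB_inj[OF \<phi> e] iB_inj[OF \<psi> e] chu_homD(1)[OF iB_homD[OF \<phi>]]
    by (auto simp: inj_on_def fst_chu_comp)
qed

definition chu_incl :: "('p, 'x, 's) chu \<Rightarrow> ('p, 'x, 's) chu \<Rightarrow> ('p, 'x) chu_mor" where
  "chu_incl C D = (\<lambda>a\<in>points C. a, \<lambda>y\<in>states D. y)"

lemma chu_incl_iB_hom:
  assumes "chu_biextensional C" "points C \<subseteq> points D" "states D \<subseteq> states C"
    and "\<And>a y. a \<in> points C \<Longrightarrow> y \<in> states D \<Longrightarrow> rel D a y = rel C a y"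
  shows "chu_incl C D \<in> iB_hom C D"
  by (rule iB_injI) (use assms in \<open>auto simp: chu_hom_def chu_incl_def inj_on_def\<close>)

section \<open>Points of a colimit\<close>

text \<open>
  The points of \<open>D\<close> hit by the cocone, with one representative of each class of states that agree on
  them, form a subobject through which the cocone factors; so the inclusion of this subobject is a
  split epimorphism.
\<close>

lemma iB_colimit_points:
  fixes D :: "('p,'x,'s) chu"
  assumes e: "inj (e :: 's \<Rightarrow> 'x)" and om: "iB_omega_sequence C \<phi>" and co: "iB_colimit C \<phi> D \<psi>"
    and d: "d \<in> points D"
  shows "\<exists>i\<ge>1. d \<in> fst (\<psi> i) ` points (C i)"
proof -
  have cc: "iB_cocone C \<phi> D \<psi>" using co by (simp add: iB_colimit_def)
  have Db: "chu_biextensional D" using cc by (simp add: iB_cocone_def)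
  have Cb: "chu_biextensional (C i)" if "i \<ge> 1" for i
    using om that by (simp add: iB_omega_sequence_def)
  have ps: "\<psi> i \<in> iB_hom (C i) D" "chu_comp (C i) D (\<psi> (i + 1)) (\<phi> i) = \<psi> i" if "i \<ge> 1" for i
    using cc that by (auto simp: iB_cocone_def)
  define A where "A = (\<Union>i\<in>{1..}. fst (\<psi> i) ` points (C i))"
  have AD: "A \<subseteq> points D" using chu_homD(1)[OF iB_homD[OF ps(1)]] by (auto simp: A_def)
  \<comment> \<open>The predicate depends on \<open>x\<close> only through its values on
    \<open>A\<close>, so states that agree on \<open>A\<close> receive the same
    representative.\<close>
  define rp where "rp x = (SOME y. y \<in> states D \<and> (\<forall>a\<in>A. rel D a y = rel D a x))" for x
  have rp: "rp x \<in> states D \<and> (\<forall>a\<in>A. rel D a (rp x) = rel D a x)" if "x \<in> states D" for x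
    unfolding rp_def by (rule someI[of _ x]) (use that in auto)
  have rp_eq: "rp x = rp y" if "\<forall>a\<in>A. rel D a x = rel D a y" for x y
    unfolding rp_def using that by (intro arg_cong[where f=Eps]) auto
  define D' where "D' = \<lparr>points = A, states = rp ` states D, rel = rel D\<rparr>"
  have D'b: "chu_biextensional D'"
    unfolding chu_biextensional_def
  proof
    show "chu_extensional D'"
      using rp rp_eq by (auto simp: chu_extensional_def D'_def)
    have "a = b" if "a \<in> A" "b \<in> A" "\<And>x. x \<in> states D \<Longrightarrow> rel D a (rp x) = rel D b (rp x)" for a b
      using Db that rp AD unfolding chu_biextensional_def chu_separable_def by (metis subsetD)
    then show "chu_separable D'"
      by (auto simp: chu_separable_def D'_def)
  qed
  define \<iota> where "\<iota> = (\<lambda>a\<in>A. a, \<lambda>y\<in>states D. rp y)"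
  have \<iota>: "\<iota> \<in> iB_hom D' D"
    by (rule iB_injI[OF _ D'b])
      (use AD rp in \<open>auto simp: \<iota>_def D'_def chu_hom_def inj_on_def\<close>)
  define \<psi>' where "\<psi>' i = (fst (\<psi> i), \<lambda>y\<in>rp ` states D. snd (\<psi> i) y)" for i
  have cc': "iB_cocone C \<phi> D' \<psi>'"
    unfolding iB_cocone_def
  proof (intro conjI allI impI D'b)
    fix i :: nat assume i: "1 \<le> i"
    have "\<psi>' i \<in> chu_hom (C i) D'"
      unfolding chu_hom_def
    proof (intro CollectI conjI ballI)
      note h = iB_homD[OF ps(1)[OF i]]
      show "fst (\<psi>' i) \<in> points (C i) \<rightarrow>\<^sub>E points D'"
        using h i by (auto simp: \<psi>'_def D'_def A_def chu_hom_def)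
      show "snd (\<psi>' i) \<in> states D' \<rightarrow>\<^sub>E states (C i)"
        using chu_homD(2)[OF h] rp by (auto simp: \<psi>'_def D'_def)
      fix a y assume "a \<in> points (C i)" "y \<in> states D'"
      then show "rel D' (fst (\<psi>' i) a) y = rel (C i) a (snd (\<psi>' i) y)"
        using chu_homD(3)[OF h] rp by (auto simp: \<psi>'_def D'_def)
    qed
    then show "\<psi>' i \<in> iB_hom (C i) D'"
      using iB_inj[OF ps(1)[OF i] e] by (intro iB_injI Cb i) (simp_all add: \<psi>'_def)
    have "snd (\<phi> i) (snd (\<psi> (i+1)) y) = snd (\<psi> i) y" if "y \<in> states D" for y
      using snd_chu_comp[OF that, of "C i" "\<psi> (i+1)" "\<phi> i"] ps(2)[OF i] by simp
    then show "chu_comp (C i) D' (\<psi>' (i + 1)) (\<phi> i) = \<psi>' i"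
      using arg_cong[OF ps(2)[OF i], of fst] rp
      by (auto simp: chu_comp_def \<psi>'_def D'_def compose_def fun_eq_iff prod_eq_iff)
  qed
  then obtain \<theta> where \<theta>: "\<theta> \<in> iB_hom D D'" "\<And>i. i \<ge> 1 \<Longrightarrow> chu_comp (C i) D' \<theta> (\<psi> i) = \<psi>' i"
    using co unfolding iB_colimit_def by blast
  \<comment> \<open>The round trip \<open>?t\<close> through \<open>D'\<close> and the identity both
    mediate from the cocone \<open>\<psi>\<close> to itself, so uniqueness will make them
    equal.\<close>
  let ?id = "chu_incl D D" and ?t = "chu_comp D D \<iota> \<theta>"
  have id: "?id \<in> iB_hom D D" by (rule chu_incl_iB_hom[OF Db]) auto
  have t: "?t \<in> iB_hom D D" by (rule iB_hom_comp[OF e Db \<theta>(1) \<iota>])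
  have "chu_comp (C i) D ?id (\<psi> i) = \<psi> i" if i: "i \<ge> 1" for i
    using chu_homD(1)[OF iB_homD[OF ps(1)[OF i]]]
    by (intro chu_comp_eqI[OF iB_homD[OF ps(1)[OF i]] iB_homD[OF id] iB_homD[OF ps(1)[OF i]] Cb[OF i]])
      (simp add: chu_incl_def)
  moreover have "chu_comp (C i) D ?t (\<psi> i) = \<psi> i" if i: "i \<ge> 1" for i
  proof (rule chu_comp_eqI[OF iB_homD[OF ps(1)[OF i]] iB_homD[OF t] iB_homD[OF ps(1)[OF i]] Cb[OF i]])
    fix a assume a: "a \<in> points (C i)"
    have "fst \<theta> (fst (\<psi> i) a) = fst (\<psi> i) a"
      using arg_cong[OF \<theta>(2)[OF i], of "\<lambda>f. fst f a"] a by (simp add: fst_chu_comp \<psi>'_def)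
    moreover have "fst (\<psi> i) a \<in> A" using a i by (auto simp: A_def)
    ultimately show "fst ?t (fst (\<psi> i) a) = fst (\<psi> i) a"
      using a AD by (auto simp: fst_chu_comp \<iota>_def)
  qed
  ultimately have "?t = ?id"
    using co cc id t unfolding iB_colimit_def by blast
  then have "fst \<iota> (fst \<theta> d) = d"
    using fst_chu_comp[OF d, of D \<iota> \<theta>] d by (simp add: chu_incl_def)
  moreover have "fst \<theta> d \<in> A" using chu_homD(1)[OF iB_homD[OF \<theta>(1)] d] by (simp add: D'_def)
  ultimately have "d \<in> A" by (simp add: \<iota>_def)
  then show ?thesis by (auto simp: A_def)
qed

text \<open>Each leg factors through the next one. This gathers points that are hit at different
  stages into one common stage.\<close>

lemma iB_cocone_image_mono:
  assumes om: "iB_omega_sequence C \<phi>" and cc: "iB_cocone C \<phi> D \<psi>" and ij: "1 \<le> i" "i \<le> j"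
  shows "fst (\<psi> i) ` points (C i) \<subseteq> fst (\<psi> j) ` points (C j)"
  using ij(2)
proof (induction j rule: dec_induct)
  case (step n)
  then have n: "n \<ge> 1" using ij by simp
  have "fst (\<psi> n) a = fst (\<psi> (n+1)) (fst (\<phi> n) a)" if "a \<in> points (C n)" for a
    using cc n fst_chu_comp[OF that, of D "\<psi> (n+1)" "\<phi> n"] by (simp add: iB_cocone_def)
  moreover have "\<phi> n \<in> chu_hom (C n) (C (n+1))"
    using om n by (simp add: iB_omega_sequence_def iB_hom_def)
  ultimately have "fst (\<psi> n) ` points (C n) \<subseteq> fst (\<psi> (Suc n)) ` points (C (Suc n))"
    using chu_homD(1) by fastforce
  then show ?case using step by blast
qed simp

section \<open>Sufficiency of the two alternatives\<close>

lemma discrete_finite_object: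
  fixes F :: "('p,'x,'s) chu"
  assumes e: "inj (e :: 's \<Rightarrow> 'x)" and F: "chu_biextensional F"
    and fin: "finite (points F)" and disc: "chu_discrete F"
  shows "iB_finite_object F"
  unfolding iB_finite_object_def
proof (intro conjI F allI impI)
  fix C :: "nat \<Rightarrow> ('p,'x,'s) chu" and \<phi> D \<psi> \<theta>
  assume om: "iB_omega_sequence C \<phi>" and co: "iB_colimit C \<phi> D \<psi>" and th: "\<theta> \<in> iB_hom F D"
  have cc: "iB_cocone C \<phi> D \<psi>" using co by (simp add: iB_colimit_def)
  note th' = chu_homD[OF iB_homD[OF th]]
  have "\<exists>i\<ge>1. fst \<theta> b \<in> fst (\<psi> i) ` points (C i)" if "b \<in> points F" for b
    using iB_colimit_points[OF e om co] th'(1)[OF that] by blast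
  then obtain n where n: "n b \<ge> 1" "fst \<theta> b \<in> fst (\<psi> (n b)) ` points (C (n b))"
    if "b \<in> points F" for b by metis
  \<comment> \<open>Inserting 1 keeps the stage legitimate when \<open>F\<close> has no
    points.\<close>
  define N where "N = Max (insert 1 (n ` points F))"
  have N: "n b \<le> N" if "b \<in> points F" for b using fin that by (auto simp: N_def)
  have N1: "N \<ge> 1" using fin by (auto simp: N_def)
  have ps: "\<psi> N \<in> iB_hom (C N) D" using cc N1 by (simp add: iB_cocone_def)
  have "\<exists>a\<in>points (C N). fst (\<psi> N) a = fst \<theta> b" if "b \<in> points F" for b
    using iB_cocone_image_mono[OF om cc n(1)[OF that] N[OF that]] n(2)[OF that] by force
  then obtain g where g: "g b \<in> points (C N)" "fst (\<psi> N) (g b) = fst \<theta> b"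
    if "b \<in> points F" for b by metis
  \<comment> \<open>Discreteness supplies the state map: each state of the stage, read along
    \<open>g\<close>, is a function on the points of \<open>F\<close> and is represented by a
    state.\<close>
  obtain h where h: "h y \<in> states F" "\<And>b. b \<in> points F \<Longrightarrow> rel (C N) (g b) y = rel F b (h y)" for y
    using disc[unfolded chu_discrete_def, rule_format, of "\<lambda>b. rel (C N) (g b) y" for y] by metis
  define \<eta> where "\<eta> = (restrict g (points F), restrict h (states (C N)))"
  have \<eta>: "\<eta> \<in> iB_hom F (C N)"
  proof (rule iB_injI[OF _ F])
    show "\<eta> \<in> chu_hom F (C N)" using g h by (auto simp: \<eta>_def chu_hom_def)
    \<comment> \<open>Following \<open>g\<close> by the leg gives the injective point map of
      \<open>\<theta>\<close>.\<close>
    show "inj_on (fst \<eta>) (points F)"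
      using iB_inj[OF th e] g(2) by (auto simp: inj_on_def \<eta>_def) metis
  qed
  have "\<theta> = chu_comp F D (\<psi> N) \<eta>"
    by (rule chu_comp_eqI[OF iB_homD[OF \<eta>] iB_homD[OF ps] iB_homD[OF th] F, symmetric])
      (simp add: \<eta>_def g)
  then show "\<exists>i\<ge>1. \<exists>\<eta>\<in>iB_hom F (C i). \<theta> = chu_comp F D (\<psi> i) \<eta>"
    using N1 \<eta> by blast
qed

lemma stateless_singleton_finite_object:
  fixes F :: "('p,'x,'s) chu"
  assumes e: "inj (e :: 's \<Rightarrow> 'x)" and F: "points F = {b}" "states F = {}"
    and fin: "finite (UNIV :: 's set)"
  shows "iB_finite_object F"
proof -
  have Fb: "chu_biextensional F"
    using F by (auto simp: chu_biextensional_def chu_extensional_def chu_separable_def)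
  have "\<exists>i\<ge>1. \<exists>\<eta>\<in>iB_hom F (C i). \<theta> = chu_comp F D (\<psi> i) \<eta>"
    if om: "iB_omega_sequence C \<phi>" and co: "iB_colimit C \<phi> D \<psi>" and th: "\<theta> \<in> iB_hom F D"
    for C :: "nat \<Rightarrow> ('p,'x,'s) chu" and \<phi> D \<psi> \<theta>
  proof -
    have cc: "iB_cocone C \<phi> D \<psi>" using co by (simp add: iB_colimit_def)
    have sD: "states D = {}" using chu_homD(2)[OF iB_homD[OF th]] F by auto
    \<comment> \<open>The empty space is a finite object over a finite alphabet and maps into the
      stateless \<open>D\<close>. Its factorization through a stage forces that stage to have no
      states.\<close>
    define E :: "('p,'x,'s) chu" where "E = \<lparr>points = {}, states = {}, rel = rel F\<rparr>"
    have E: "iB_finite_object E" "chu_biextensional E"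
      using empty_chu_finite_object[OF fin e, of E] by (simp_all add: E_def)
    have "chu_incl E D \<in> iB_hom E D"
      by (rule chu_incl_iB_hom[OF E(2)]) (simp_all add: E_def sD)
    then obtain i \<eta>0 where i: "i \<ge> 1" and "\<eta>0 \<in> iB_hom E (C i)"
      using E(1) om co unfolding iB_finite_object_def by blast
    then have sCi: "states (C i) = {}"
      using chu_homD(2)[OF iB_homD] by (fastforce simp: E_def)
    obtain j where j: "j \<ge> 1" "fst \<theta> b \<in> fst (\<psi> j) ` points (C j)"
      using iB_colimit_points[OF e om co] chu_homD(1)[OF iB_homD[OF th]] F by blast
    let ?k = "max i j"
    \<comment> \<open>State maps run backwards, so every stage after a stateless one is stateless
      too.\<close>
    have sC: "states (C (i + m)) = {}" for m
    proof (induction m)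
      case (Suc m)
      have "\<phi> (i+m) \<in> chu_hom (C (i+m)) (C (i+m+1))"
        using om i by (simp add: iB_omega_sequence_def iB_hom_def)
      from chu_homD(2)[OF this] Suc show ?case by auto
    qed (simp add: sCi)
    have sk: "states (C ?k) = {}" using sC[of "?k - i"] by simp
    obtain a where a: "a \<in> points (C ?k)" "fst (\<psi> ?k) a = fst \<theta> b"
      using iB_cocone_image_mono[OF om cc j(1), of ?k] j(2) by auto
    define \<eta> where "\<eta> = (\<lambda>_\<in>{b}. a, \<lambda>_::'x. undefined :: 'x)"
    have \<eta>: "\<eta> \<in> iB_hom F (C ?k)"
      by (rule iB_injI[OF _ Fb]) (use a sk F in \<open>auto simp: chu_hom_def \<eta>_def\<close>)
    have ps: "\<psi> ?k \<in> iB_hom (C ?k) D" using cc i by (simp add: iB_cocone_def)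
    have "\<theta> = chu_comp F D (\<psi> ?k) \<eta>"
      by (rule chu_comp_eqI[OF iB_homD[OF \<eta>] iB_homD[OF ps] iB_homD[OF th] Fb, symmetric])
        (use F a in \<open>simp add: \<eta>_def\<close>)
    then show ?thesis using i \<eta> by (intro exI[of _ ?k]) auto
  qed
  then show ?thesis using Fb unfolding iB_finite_object_def by blast
qed

section \<open>Unions of points with intersections of states as colimits\<close>

text \<open>The test behind all necessity arguments: a chain of inclusions under one relation
  \<open>r\<close> has \<open>D\<close> as colimit, so the points of a finite object that reach
  \<open>D\<close> must already fit into a stage.\<close>

lemma iB_finite_object_chain:
  fixes F :: "('p,'x,'s) chu" and P :: "nat \<Rightarrow> 'p set" and S :: "nat \<Rightarrow> 'x set"
    and r :: "'p \<Rightarrow> 'x \<Rightarrow> 's"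
  defines "C \<equiv> \<lambda>i. \<lparr>points = P i, states = S i, rel = r\<rparr>"
    and "D \<equiv> \<lparr>points = \<Union>i. P i, states = \<Inter>i. S i, rel = r\<rparr>"
  assumes e: "inj (e :: 's \<Rightarrow> 'x)" and P: "mono P" and S: "antimono S"
    and Cb: "\<And>i. chu_biextensional (C i)" and Db: "chu_biextensional D"
    and F: "iB_finite_object F" and th: "\<theta> \<in> iB_hom F D"
  shows "\<exists>i. \<exists>\<eta>\<in>chu_hom F (C i). \<forall>a\<in>points F. fst \<eta> a = fst \<theta> a"
proof -
  define \<phi> where "\<phi> i = chu_incl (C i) (C (i+1))" for i
  define \<psi> where "\<psi> i = chu_incl (C i) D" for i
  have PS: "P i \<subseteq> P (i+1)" "S (i+1) \<subseteq> S i" for i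
    using monoD[OF P, of i "i+1"] antimonoD[OF S, of i "i+1"] by auto
  have \<phi>: "\<phi> i \<in> iB_hom (C i) (C (i+1))" for i
    unfolding \<phi>_def by (rule chu_incl_iB_hom[OF Cb]) (use PS[of i] in \<open>auto simp: C_def\<close>)
  have \<psi>: "\<psi> i \<in> iB_hom (C i) D" for i
    unfolding \<psi>_def by (rule chu_incl_iB_hom[OF Cb]) (auto simp: C_def D_def)
  have om: "iB_omega_sequence C \<phi>"
    using Cb \<phi> by (simp add: iB_omega_sequence_def)
  have cc: "iB_cocone C \<phi> D \<psi>"
    unfolding iB_cocone_def
  proof (intro conjI allI impI Db \<psi>)
    fix i
    show "chu_comp (C i) D (\<psi> (i + 1)) (\<phi> i) = \<psi> i"
      by (rule chu_comp_eqI[OF iB_homD[OF \<phi>] iB_homD[OF \<psi>] iB_homD[OF \<psi>] Cb])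
        (use PS[of i] in \<open>auto simp: \<psi>_def \<phi>_def chu_incl_def C_def\<close>)
  qed
  have "\<exists>!\<theta>. \<theta> \<in> iB_hom D D' \<and> (\<forall>i\<ge>1. chu_comp (C i) D' \<theta> (\<psi> i) = \<psi>' i)"
    if cc': "iB_cocone C \<phi> D' \<psi>'" for D' \<psi>'
  proof -
    have ps': "\<psi>' i \<in> iB_hom (C i) D'" "chu_comp (C i) D' (\<psi>' (i + 1)) (\<phi> i) = \<psi>' i"
      if "i \<ge> 1" for i
      using cc' that by (auto simp: iB_cocone_def)
    note psh = chu_homD[OF iB_homD[OF ps'(1)]]
    have st: "fst (\<psi>' (i+1)) a = fst (\<psi>' i) a" if "i \<ge> 1" "a \<in> P i" for i a
      using fst_chu_comp[of a "C i" D' "\<psi>' (i+1)" "\<phi> i"] ps'(2)[OF that(1)] that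
      by (simp add: C_def \<phi>_def chu_incl_def)
    have fst_eq: "fst (\<psi>' (i+k)) a = fst (\<psi>' i) a" if "i \<ge> 1" "a \<in> P i" for i k a
    proof (induction k)
      case (Suc k)
      have "a \<in> P (i+k)" using that(2) monoD[OF P, of i "i+k"] by auto
      then show ?case using st[of "i+k" a] Suc that(1) by simp
    qed simp
    have sst: "snd (\<psi>' (i+1)) y = snd (\<psi>' i) y" if "i \<ge> 1" "y \<in> states D'" for i y
      using snd_chu_comp[of y D' "C i" "\<psi>' (i+1)" "\<phi> i"] ps'(2)[OF that(1)] that
        psh(2)[of "i+1" y]
      by (simp add: C_def \<phi>_def chu_incl_def)
    \<comment> \<open>All legs share one state map, which therefore lands in every
      \<open>S i\<close>.\<close>
    have snd_eq: "snd (\<psi>' i) y = snd (\<psi>' 1) y" if "i \<ge> 1" "y \<in> states D'" for i y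
      using that(1) by (induction i rule: dec_induct) (use sst that in auto)
    define ix where "ix a = (SOME i. i \<ge> 1 \<and> a \<in> P i)" for a
    have ix: "ix a \<ge> 1" "a \<in> P (ix a)" if "a \<in> P i" for a i
    proof -
      \<comment> \<open>The union starts at index 0 but cocones start at 1; a point of
        \<open>P 0\<close> also lies in \<open>P 1\<close>.\<close>
      have "i + 1 \<ge> 1 \<and> a \<in> P (i + 1)" using that PS(1)[of i] by auto
      from someI[of "\<lambda>i. i \<ge> 1 \<and> a \<in> P i", OF this] show "ix a \<ge> 1" "a \<in> P (ix a)"
        by (auto simp: ix_def)
    qed
    \<comment> \<open>The two legs are compared at stage \<open>ix a + i\<close>, which lies beyond
      both.\<close>
    have fst_ix: "fst (\<psi>' (ix a)) a = fst (\<psi>' i) a" if "i \<ge> 1" "a \<in> P i" for i a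
      using fst_eq[of "ix a" a i] fst_eq[OF that, of "ix a"] ix[OF that(2)]
      by (simp add: add.commute)
    define \<theta>' where
      "\<theta>' = (\<lambda>a\<in>points D. fst (\<psi>' (ix a)) a, \<lambda>y\<in>states D'. snd (\<psi>' 1) y)"
    have \<theta>': "\<theta>' \<in> iB_hom D D'"
    proof (rule iB_injI[OF _ Db])
      have "fst (\<psi>' (ix a)) a \<in> points D'" if "a \<in> P i" for a i
        using psh(1)[of "ix a" a] ix[OF that] by (simp add: C_def)
      moreover have "snd (\<psi>' 1) y \<in> S i" if "y \<in> states D'" for y i
      proof -
        have "snd (\<psi>' (i+1)) y \<in> S (i+1)" using psh(2)[of "i+1" y] that by (simp add: C_def)
        then show ?thesis using snd_eq[of "i+1" y] that PS(2)[of i] by auto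
      qed
      moreover have "rel D' (fst (\<psi>' (ix a)) a) y = r a (snd (\<psi>' 1) y)"
        if "a \<in> P i" "y \<in> states D'" for a i y
        using psh(3)[of "ix a" a y] ix[OF that(1)] snd_eq[of "ix a" y] that by (simp add: C_def)
      ultimately show "\<theta>' \<in> chu_hom D D'"
        by (auto simp: chu_hom_def \<theta>'_def D_def)
      show "inj_on (fst \<theta>') (points D)"
      proof (rule inj_onI)
        fix a b assume ab: "a \<in> points D" "b \<in> points D" "fst \<theta>' a = fst \<theta>' b"
        then obtain i j where ij: "a \<in> P i" "b \<in> P j" by (auto simp: D_def)
        \<comment> \<open>Injectivity is inherited from a single leg, at a stage that contains both
          points.\<close>
        let ?k = "i + j + 1"
        have k: "a \<in> P ?k" "b \<in> P ?k"
          using ij monoD[OF P, of i ?k] monoD[OF P, of j ?k] by auto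
        then have "fst (\<psi>' ?k) a = fst (\<psi>' ?k) b"
          using ab fst_ix[of ?k a] fst_ix[of ?k b] by (simp add: \<theta>'_def)
        then show "a = b"
          using iB_inj[OF ps'(1)[of ?k] e] k by (auto simp: C_def inj_on_def)
      qed
    qed
    have comm: "chu_comp (C i) D' \<theta>' (\<psi> i) = \<psi>' i" if i: "i \<ge> 1" for i
      by (rule chu_comp_eqI[OF iB_homD[OF \<psi>] iB_homD[OF \<theta>'] iB_homD[OF ps'(1)[OF i]] Cb])
        (use fst_ix[OF i] in \<open>auto simp: \<theta>'_def \<psi>_def chu_incl_def C_def D_def\<close>)
    have "\<chi> = \<theta>'"
      if \<chi>: "\<chi> \<in> iB_hom D D'" "\<forall>i\<ge>1. chu_comp (C i) D' \<chi> (\<psi> i) = \<psi>' i" for \<chi>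
    proof (rule chu_hom_eqI[OF iB_homD[OF \<chi>(1)] iB_homD[OF \<theta>'] Db])
      fix a assume "a \<in> points D"
      then obtain i where "a \<in> P i" by (auto simp: D_def)
      note i = ix[OF this]
      have "fst (chu_comp (C (ix a)) D' \<chi> (\<psi> (ix a))) a = fst (chu_comp (C (ix a)) D' \<theta>' (\<psi> (ix a))) a"
        using \<chi>(2) comm i by simp
      then show "fst \<chi> a = fst \<theta>' a"
        using i by (simp add: fst_chu_comp C_def \<psi>_def chu_incl_def)
    qed
    then show ?thesis using \<theta>' comm by blast
  qed
  then have "iB_colimit C \<phi> D \<psi>" using cc by (simp add: iB_colimit_def)
  then obtain i \<eta> where i: "\<eta> \<in> iB_hom F (C i)" "\<theta> = chu_comp F D (\<psi> i) \<eta>"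
    using F om th unfolding iB_finite_object_def by blast
  \<comment> \<open>The leg \<open>\<psi> i\<close> is an inclusion, so factoring leaves the point
    map unchanged.\<close>
  have "fst \<eta> a = fst \<theta> a" if "a \<in> points F" for a
    using i(2) that chu_homD(1)[OF iB_homD[OF i(1)] that]
    by (simp add: fst_chu_comp \<psi>_def chu_incl_def)
  then show ?thesis using iB_homD[OF i(1)] by blast
qed

section \<open>Necessity: finitely many points\<close>

text \<open>An infinite type absorbs its double; the two summands of an embedding of
  \<open>'a + 'a\<close> have disjoint images. This makes room for the copy of \<open>F\<close> and
  for a fresh state.\<close>

lemma infinite_two_disjoint_embeddings:
  assumes "infinite (UNIV :: 'a set)"
  shows "\<exists>(f :: 'a \<Rightarrow> 'a) (g :: 'a \<Rightarrow> 'a). inj f \<and> inj g \<and> range f \<inter> range g = {}"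
proof -
  have "(card_of (UNIV :: ('a + 'a) set), card_of (UNIV :: 'a set)) \<in> ordLeq"
    using card_of_Plus_infinite1[OF assms ordIso_imp_ordLeq[OF card_of_refl]] ordIso_imp_ordLeq
    by (simp flip: UNIV_Plus_UNIV)
  then have "\<exists>h :: 'a + 'a \<Rightarrow> 'a. inj h"
    by (simp flip: card_of_ordLeq)
  then obtain h :: "'a + 'a \<Rightarrow> 'a" where h: "inj h" by blast
  show ?thesis
    by (rule exI[of _ "h \<circ> Inl"], rule exI[of _ "h \<circ> Inr"]) (use h in \<open>auto simp: inj_def\<close>)
qed

text \<open>
  Deleting points of \<open>F\<close> can destroy extensionality, so a copy of \<open>F\<close> is kept alongside; the extra
  state \<open>u\<close>, a twin of \<open>y0\<close> on \<open>F\<close>, separates every point from its copy.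
\<close>

lemma iB_finite_object_finite_points:
  fixes F :: "('p,'x,'s) chu" and zero one :: 's
  assumes 01: "zero \<noteq> one" and e: "inj (e :: 's \<Rightarrow> 'x)"
    and p: "infinite (UNIV :: 'p set)" and x: "infinite (UNIV :: 'x set)"
    and F: "iB_finite_object F"
  shows "finite (points F)"
proof (rule ccontr)
  assume inf: "infinite (points F)"
  have Fb: "chu_extensional F" "chu_separable F"
    using F by (auto simp: iB_finite_object_def chu_biextensional_def)
  obtain q :: "nat \<Rightarrow> 'p" where q: "inj q" "range q \<subseteq> points F"
    using infinite_countable_subset[OF inf] by blast
  \<comment> \<open>Separability needs a state to tell two distinct points apart, so
    \<open>F\<close> has one.\<close>
  have "q 0 \<noteq> q 1" using q(1) by (simp add: inj_eq)
  then obtain y0 where y0: "y0 \<in> states F"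
    using Fb(2) q(2) unfolding chu_separable_def by blast
  obtain f g :: "'p \<Rightarrow> 'p" where f: "inj f" and g: "inj g" and "range f \<inter> range g = {}"
    using infinite_two_disjoint_embeddings[OF p] by blast
  then have fg: "f a \<noteq> g b" for a b by blast
  obtain j j' :: "'x \<Rightarrow> 'x" where j: "inj j" and "range j \<inter> range j' = {}"
    using infinite_two_disjoint_embeddings[OF x] by blast
  then obtain u where u: "\<And>a. j a \<noteq> u" by blast
  \<comment> \<open>A map without fixed points, so that \<open>u\<close> disagrees with
    \<open>y0\<close> everywhere on the copy.\<close>
  define \<tau> where "\<tau> v = (if v = zero then one else zero)" for v
  have \<tau>: "\<tau> v \<noteq> v" for v using 01 by (simp add: \<tau>_def)
  \<comment> \<open>The \<open>f\<close>-copy reads \<open>u\<close> as \<open>y0\<close>, while the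
    \<open>g\<close>-copy reads it as the \<open>\<tau>\<close>-image of the value of
    \<open>y0\<close>.\<close>
  define r where "r c z =
    (if c \<in> range f then rel F (inv f c) (if z = u then y0 else inv j z)
     else if z = u then \<tau> (rel F (inv g c) y0) else rel F (inv g c) (inv j z))" for c z
  have r: "r (f b) (j y) = rel F b y" "r (g b) (j y) = rel F b y"
    "r (f b) u = rel F b y0" "r (g b) u = \<tau> (rel F b y0)" for b y
    using f g j u fg[symmetric] by (auto simp: r_def image_iff)
  define B where "B i = points F - q ` {Suc i..}" for i
  define P where "P i = f ` B i \<union> g ` points F" for i
  define S where "S = insert u (j ` states F)"
  have B0: "q 0 \<in> B i" for i using q by (auto simp: B_def inj_eq)
  \<comment> \<open>The full \<open>g\<close>-copy distinguishes the old states. If \<open>u\<close>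
    agreed with an old state, the value of \<open>y0\<close> at \<open>q 0\<close> would be a fixed
    point of \<open>\<tau>\<close>; this is why \<open>q 0\<close> is never deleted.\<close>
  have bi: "chu_biextensional \<lparr>points = f ` A \<union> g ` points F, states = S, rel = r\<rparr>"
    if A: "A \<subseteq> points F" "q 0 \<in> A" for A
    unfolding chu_biextensional_def
  proof
    have "x = y" if "x \<in> states F" "y \<in> states F" "\<forall>b\<in>points F. rel F b x = rel F b y" for x y
      using that Fb(1) by (auto simp: chu_extensional_def)
    moreover have False
      if "\<forall>b\<in>A. rel F b x = rel F b y0" "\<forall>b\<in>points F. rel F b x = \<tau> (rel F b y0)" for x
      using that A \<tau> by (metis subsetD)
    moreover have False
      if "\<forall>b\<in>A. rel F b y0 = rel F b x" "\<forall>b\<in>points F. \<tau> (rel F b y0) = rel F b x" for x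
      using that A \<tau> by (metis subsetD)
    ultimately show "chu_extensional \<lparr>points = f ` A \<union> g ` points F, states = S, rel = r\<rparr>"
      by (auto simp: chu_extensional_def S_def r ball_Un)
    have sep: "a = b" if "a \<in> points F" "b \<in> points F" "\<forall>y\<in>states F. rel F a y = rel F b y" for a b
      using that Fb(2) by (auto simp: chu_separable_def)
    moreover have False
      if "a \<in> points F" "b \<in> points F" "\<forall>y\<in>states F. rel F a y = rel F b y"
        "rel F a y0 = \<tau> (rel F b y0)" for a b
      using sep[OF that(1-3)] that(4) \<tau> by metis
    moreover have False
      if "a \<in> points F" "b \<in> points F" "\<forall>y\<in>states F. rel F a y = rel F b y"
        "\<tau> (rel F a y0) = rel F b y0" for a b
      using sep[OF that(1-3)] that(4) \<tau> by metis
    ultimately show "chu_separable \<lparr>points = f ` A \<union> g ` points F, states = S, rel = r\<rparr>"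
      using A(1) unfolding chu_separable_def S_def
      by (simp add: r ball_Un) blast
  qed
  have PB: "(\<Union>i. P i) = f ` points F \<union> g ` points F"
  proof -
    have "\<exists>i. b \<in> B i" if "b \<in> points F" for b
    proof (cases "b \<in> range q")
      case True
      then obtain n where "b = q n" by blast
      then have "b \<in> B n" using that q(1) by (auto simp: B_def inj_eq)
      then show ?thesis by blast
    qed (use that in \<open>auto simp: B_def\<close>)
    moreover have "B i \<subseteq> points F" for i by (auto simp: B_def)
    ultimately have "(\<Union>i. B i) = points F" by blast
    then show ?thesis unfolding P_def by blast
  qed
  define D where "D = \<lparr>points = \<Union>i. P i, states = \<Inter>i::nat. S, rel = r\<rparr>"
  define \<theta> where "\<theta> = (\<lambda>b\<in>points F. f b, \<lambda>z\<in>S. if z = u then y0 else inv j z)"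
  have \<theta>: "\<theta> \<in> iB_hom F D"
  proof (rule iB_injI)
    show "\<theta> \<in> chu_hom F D"
      using y0 j u by (auto simp: \<theta>_def chu_hom_def D_def PB S_def r)
    show "chu_biextensional F" using F by (simp add: iB_finite_object_def)
    show "inj_on (fst \<theta>) (points F)" using f by (auto simp: \<theta>_def inj_on_def)
  qed
  have "\<exists>i. \<exists>\<eta>\<in>chu_hom F \<lparr>points = P i, states = S, rel = r\<rparr>. \<forall>a\<in>points F. fst \<eta> a = fst \<theta> a"
  proof (rule iB_finite_object_chain[OF e _ _ _ _ F \<theta>[unfolded D_def]])
    show "mono P" by (rule monoI) (auto simp: P_def B_def)
    show "antimono (\<lambda>_::nat. S)" by (rule antimonoI) simp
    show "chu_biextensional \<lparr>points = P i, states = S, rel = r\<rparr>" for i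
      unfolding P_def by (rule bi) (use B0 in \<open>auto simp: B_def\<close>)
    show "chu_biextensional \<lparr>points = \<Union>i. P i, states = \<Inter>i::nat. S, rel = r\<rparr>"
      unfolding PB using bi[of "points F"] q by auto
  qed
  then obtain i \<eta> where i: "\<eta> \<in> chu_hom F \<lparr>points = P i, states = S, rel = r\<rparr>"
    "\<And>a. a \<in> points F \<Longrightarrow> fst \<eta> a = fst \<theta> a" by blast
  \<comment> \<open>Stage \<open>i\<close> lacks \<open>f (q (Suc i))\<close>, and the copy
    \<open>g\<close> lies in a disjoint range.\<close>
  have qi: "q (Suc i) \<in> points F" using q by auto
  then have "f (q (Suc i)) \<in> P i"
    using chu_homD(1)[OF i(1) qi] i(2)[OF qi] by (simp add: \<theta>_def)
  then show False
    using fg f by (auto simp: P_def B_def inj_eq)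
qed

section \<open>Necessity: discreteness\<close>

text \<open>
  If \<open>f\<close> is a function missed by \<open>F\<close>, the space whose states are all functions extending a state of
  \<open>F\<close> is the colimit of its enlargements by all but finitely many of a sequence of extensions of \<open>f\<close>.
\<close>

lemma iB_finite_object_discrete:
  fixes F :: "('p,'x,'s) chu" and zero one :: 's and e :: "('p \<Rightarrow> 's) \<Rightarrow> 'x"
  assumes 01: "zero \<noteq> one" and e: "inj e"
    and p: "infinite (UNIV :: 'p set)"
    and F: "iB_finite_object F" and fin: "finite (points F)" and ne: "states F \<noteq> {}"
  shows "chu_discrete F"
proof (rule ccontr)
  assume "\<not> chu_discrete F"
  then obtain f where f: "\<And>y. y \<in> states F \<Longrightarrow> \<exists>b\<in>points F. f b \<noteq> rel F b y"
    unfolding chu_discrete_def by blast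
  have e': "inj (\<lambda>v. e (\<lambda>_. v))" using e by (auto simp: inj_def fun_eq_iff)
  have Fb: "chu_biextensional F" using F by (simp add: iB_finite_object_def)
  obtain q :: "nat \<Rightarrow> 'p" where q: "inj q" "range q \<subseteq> - points F"
    using infinite_countable_subset[of "- points F"] fin p by (auto simp: Compl_eq_Diff_UNIV)
  define Y where "Y = {h. \<exists>y\<in>states F. \<forall>b\<in>points F. h b = rel F b y}"
  \<comment> \<open>Every \<open>h n\<close> restricts to the missed function \<open>f\<close>,
    hence lies outside \<open>Y\<close>; the mark at \<open>q n\<close>, outside \<open>F\<close>,
    makes these extensions pairwise distinct even over a finite alphabet.\<close>
  define h where "h n c = (if c \<in> points F then f c else if c = q n then one else zero)" for n c
  have hY: "h n \<notin> Y" for n using f by (fastforce simp: Y_def h_def)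
  have hn: "h m \<noteq> h n" if "m \<noteq> n" for m n
  proof
    assume "h m = h n"
    then have "h m (q m) = h n (q m)" by simp
    moreover have "q m \<notin> points F" "q m \<noteq> q n" using q that by (auto simp: inj_eq)
    ultimately show False using 01 by (simp add: h_def)
  qed
  define S where "S i = e ` (Y \<union> h ` {i..})" for i
  \<comment> \<open>Each \<open>h n\<close> has dropped out of \<open>S (Suc n)\<close>, so only the
    functions in \<open>Y\<close> survive.\<close>
  have SY: "(\<Inter>i. S i) = e ` Y"
  proof
    show "(\<Inter>i. S i) \<subseteq> e ` Y"
    proof
      fix z assume z: "z \<in> (\<Inter>i. S i)"
      show "z \<in> e ` Y"
      proof (rule ccontr)
        assume nz: "z \<notin> e ` Y"
        have "z \<in> S 0" using z by blast
        then obtain n where n: "z = e (h n)" using nz by (auto simp: S_def)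
        have "z \<in> S (Suc n)" using z by blast
        then obtain m where "m \<ge> Suc n" "z = e (h m)" using nz by (auto simp: S_def)
        then show False using n hn[of m n] e by (simp add: inj_eq)
      qed
    qed
  qed (auto simp: S_def)
  define r where "r c z = inv e z c" for c z
  have r: "r c (e k) = k c" for c k using e by (simp add: r_def)
  \<comment> \<open>Two points of \<open>F\<close> are separated by its own states. At a point
    outside \<open>F\<close> the value of an extension is free, and \<open>?v\<close> makes it
    differ from the value at the other point; \<open>ne\<close> provides a state to extend.\<close>
  have Ysep: "a = b" if ab: "\<And>k. k \<in> Y \<Longrightarrow> k a = k b" for a b
  proof (rule ccontr)
    assume "a \<noteq> b"
    have ext: "(\<lambda>c. if c \<in> points F then rel F c y else k c) \<in> Y" if "y \<in> states F" for y k
      using that by (auto simp: Y_def)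
    obtain y where y: "y \<in> states F" using ne by blast
    let ?v = "\<lambda>w. (if w = zero then one else zero)"
    consider "a \<in> points F" "b \<in> points F" | "b \<notin> points F" | "a \<notin> points F" by blast
    then show False
    proof cases
      case 1
      then have "rel F a y = rel F b y" if "y \<in> states F" for y
        using ab[OF ext[OF that]] by simp
      then show False using Fb 1 \<open>a \<noteq> b\<close>
        unfolding chu_biextensional_def chu_separable_def by blast
    next
      case 2
      let ?k = "\<lambda>c. if c = b then ?v (if a \<in> points F then rel F a y else zero) else zero"
      show False using ab[OF ext[OF y, of ?k]] 2 \<open>a \<noteq> b\<close> 01 by (auto split: if_splits)
    next
      case 3
      let ?k = "\<lambda>c. if c = a then ?v (if b \<in> points F then rel F b y else zero) else zero"
      show False using ab[OF ext[OF y, of ?k]] 3 \<open>a \<noteq> b\<close> 01 by (auto split: if_splits)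
    qed
  qed
  \<comment> \<open>States encode functions on all points, so extensionality is automatic, and
    \<open>Y\<close> already separates.\<close>
  have bi: "chu_biextensional \<lparr>points = UNIV, states = e ` T, rel = r\<rparr>" if "Y \<subseteq> T" for T
    using that
    by (auto simp: chu_biextensional_def chu_extensional_def chu_separable_def r fun_eq_iff[symmetric]
        intro: Ysep)
  have "\<forall>k\<in>Y. \<exists>y. y \<in> states F \<and> (\<forall>b\<in>points F. k b = rel F b y)"
    by (auto simp: Y_def)
  then obtain m where m: "\<forall>k\<in>Y. m k \<in> states F \<and> (\<forall>b\<in>points F. k b = rel F b (m k))"
    by metis
  define \<theta> where "\<theta> = (\<lambda>b\<in>points F. b, \<lambda>z\<in>e ` Y. m (inv e z))"
  have \<theta>: "\<theta> \<in> iB_hom F \<lparr>points = \<Union>i::nat. UNIV, states = \<Inter>i. S i, rel = r\<rparr>"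
  proof (rule iB_injI[OF _ Fb])
    show "\<theta> \<in> chu_hom F \<lparr>points = \<Union>i::nat. UNIV, states = \<Inter>i. S i, rel = r\<rparr>"
      unfolding SY using m e by (auto simp: \<theta>_def chu_hom_def r)
    show "inj_on (fst \<theta>) (points F)" by (auto simp: \<theta>_def inj_on_def)
  qed
  have "\<exists>i. \<exists>\<eta>\<in>chu_hom F \<lparr>points = UNIV, states = S i, rel = r\<rparr>. \<forall>a\<in>points F. fst \<eta> a = fst \<theta> a"
  proof (rule iB_finite_object_chain[OF e' _ _ _ _ F \<theta>])
    show "mono (\<lambda>_::nat. UNIV :: 'p set)" by (rule monoI) simp
    show "antimono S" by (rule antimonoI) (auto simp: S_def)
    show "chu_biextensional \<lparr>points = UNIV, states = S i, rel = r\<rparr>" for i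
      unfolding S_def by (rule bi) auto
    show "chu_biextensional \<lparr>points = \<Union>i::nat. UNIV, states = \<Inter>i. S i, rel = r\<rparr>"
      unfolding SY using bi[of Y] by simp
  qed
  then obtain i \<eta> where i: "\<eta> \<in> chu_hom F \<lparr>points = UNIV, states = S i, rel = r\<rparr>"
    "\<And>a. a \<in> points F \<Longrightarrow> fst \<eta> a = fst \<theta> a" by blast
  \<comment> \<open>The extension \<open>h i\<close> is still a state of stage \<open>i\<close>, so
    its pullback along \<open>\<eta>\<close> would be a state of \<open>F\<close> representing
    \<open>f\<close>.\<close>
  have hi: "e (h i) \<in> S i" by (auto simp: S_def)
  have "f b = rel F b (snd \<eta> (e (h i)))" if "b \<in> points F" for b
    using chu_homD(3)[OF i(1) that, of "e (h i)"] i(2)[OF that] hi that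
    by (simp add: \<theta>_def r h_def)
  moreover have "snd \<eta> (e (h i)) \<in> states F" using chu_homD(2)[OF i(1)] hi by simp
  ultimately show False using f by blast
qed

section \<open>Necessity: stateless spaces\<close>

text \<open>The states of a one-point space amount to a set of letters. An infinite alphabet has a
  decreasing sequence of nonempty such sets with empty intersection: \<open>F\<close> maps to the
  stateless colimit, but to no stage, since each stage has a state.\<close>

lemma iB_finite_object_stateless_finite_alphabet:
  fixes F :: "('p,'x,'s) chu" and e :: "'s \<Rightarrow> 'x"
  assumes e: "inj e" and F: "iB_finite_object F" and Y: "states F = {}"
  shows "finite (UNIV :: 's set)"
proof (rule ccontr)
  assume "infinite (UNIV :: 's set)"
  then obtain v :: "nat \<Rightarrow> 's" where v: "inj v"
    using infinite_countable_subset by blast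
  have Fb: "chu_biextensional F" using F by (simp add: iB_finite_object_def)
  \<comment> \<open>Without states separability leaves at most one point; the inclusion also covers
    the space with no points.\<close>
  then have "\<exists>c. points F \<subseteq> {c}"
    using Y unfolding chu_biextensional_def chu_separable_def by blast
  then obtain c where c: "points F \<subseteq> {c}" by blast
  define S where "S i = e ` v ` {i..}" for i
  have SY: "(\<Inter>i. S i) = {}"
  proof (rule ccontr)
    assume "(\<Inter>i. S i) \<noteq> {}"
    then obtain z where z: "\<And>i. z \<in> S i" by blast
    obtain n where n: "z = e (v n)" using z[of 0] by (auto simp: S_def)
    from z[of "Suc n"] show False using n e v by (auto simp: S_def inj_eq)
  qed
  define r :: "'p \<Rightarrow> 'x \<Rightarrow> 's" where "r = (\<lambda>_. inv e)"
  define \<theta> where "\<theta> = (\<lambda>_\<in>points F. c, \<lambda>_::'x. undefined :: 'x)"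
  have \<theta>: "\<theta> \<in> iB_hom F \<lparr>points = \<Union>i::nat. {c}, states = \<Inter>i. S i, rel = r\<rparr>"
    unfolding SY
    by (rule iB_injI[OF _ Fb]) (use c in \<open>auto simp: \<theta>_def chu_hom_def inj_on_def\<close>)
  have "\<exists>i. \<exists>\<eta>\<in>chu_hom F \<lparr>points = {c}, states = S i, rel = r\<rparr>. \<forall>a\<in>points F. fst \<eta> a = fst \<theta> a"
  proof (rule iB_finite_object_chain[OF e _ _ _ _ F \<theta>])
    show "mono (\<lambda>_::nat. {c})" by (rule monoI) simp
    show "antimono S" by (rule antimonoI) (auto simp: S_def)
    show "chu_biextensional \<lparr>points = {c}, states = S i, rel = r\<rparr>" for i
      using e by (auto simp: chu_biextensional_def chu_extensional_def chu_separable_def S_def r_def)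
    show "chu_biextensional \<lparr>points = \<Union>i::nat. {c}, states = \<Inter>i. S i, rel = r\<rparr>"
      unfolding SY by (auto simp: chu_biextensional_def chu_extensional_def chu_separable_def)
  qed
  then obtain i \<eta> where "\<eta> \<in> chu_hom F \<lparr>points = {c}, states = S i, rel = r\<rparr>" by blast
  from chu_homD(2)[OF this, of "e (v i)"] show False using Y by (simp add: S_def)
qed

text \<open>The alternatives follow whether \<open>F\<close> has states: with a state, finiteness
  forces discreteness; without one, it forces a finite alphabet, and excluding the empty space
  leaves exactly one point.\<close>

theorem theorem4p7:
  fixes F :: "('p, 'x, 's) chu" and zero one :: 's
  assumes "zero \<noteq> one"
    and "infinite (UNIV :: 'p set)"
    and "\<exists>e :: ('p \<Rightarrow> 's) \<Rightarrow> 'x. inj e"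
    and "chu_biextensional F"
    and "\<not> (points F = {} \<and> states F = {} \<and> finite (UNIV :: 's set))"
  shows "iB_finite_object F \<longleftrightarrow>
    (finite (points F) \<and> chu_discrete F) \<or>
    (is_singleton (points F) \<and> states F = {} \<and> finite (UNIV :: 's set))"
proof -
  obtain e :: "('p \<Rightarrow> 's) \<Rightarrow> 'x" where e: "inj e" using assms(3) by blast
  have e': "inj (\<lambda>v. e (\<lambda>_. v))" using e by (auto simp: inj_def fun_eq_iff)
  \<comment> \<open>Indicator functions of single points embed \<open>'p\<close> into
    \<open>'x\<close>, so \<open>'x\<close> is infinite as well.\<close>
  have "inj (\<lambda>a. e (\<lambda>b. if b = a then one else zero))"
    using e assms(1) by (auto intro!: injI simp: inj_eq fun_eq_iff split: if_splits)
  then have x: "infinite (UNIV :: 'x set)"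
    using assms(2) finite_imageD[of "\<lambda>a. e (\<lambda>b. if b = a then one else zero)" UNIV]
    by (meson finite_subset subset_UNIV)
  show ?thesis
  proof
    assume F: "iB_finite_object F"
    have fin: "finite (points F)"
      by (rule iB_finite_object_finite_points[OF assms(1) e' assms(2) x F])
    show "(finite (points F) \<and> chu_discrete F) \<or>
      (is_singleton (points F) \<and> states F = {} \<and> finite (UNIV :: 's set))"
    proof (cases "states F = {}")
      case True
      have s: "finite (UNIV :: 's set)"
        by (rule iB_finite_object_stateless_finite_alphabet[OF e' F True])
      then obtain b where "b \<in> points F" using assms(5) True by blast
      then have "points F = {b}"
        using assms(4) True unfolding chu_biextensional_def chu_separable_def by blast
      then show ?thesis using True s by (simp add: is_singleton_def)
    next
      case False
      then show ?thesis
        using iB_finite_object_discrete[OF assms(1) e assms(2) F fin] fin by blast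
    qed
  next
    assume "(finite (points F) \<and> chu_discrete F) \<or>
      (is_singleton (points F) \<and> states F = {} \<and> finite (UNIV :: 's set))"
    then show "iB_finite_object F"
      using discrete_finite_object[OF e' assms(4)] stateless_singleton_finite_object[OF e']
      by (auto simp: is_singleton_def)
  qed
qed

end
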